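(* Let $G$ be a graph. The linear map $\Delta_G:H(\mathcal{G})\to H(\mathcal{G})\otimes H(\mathcal{G})$ given on $F\in M(\mathcal{G})$ by the combinatorial formula $$\Delta_G(F)=\sum_{U\uplus V=V(F)}F[U]\otimes F[V]$$ coincides with the coproduct $\Delta_G$ defined by linearity and the three rules: $\Delta_G(\mathbf{1})=\mathbf{1}\otimes\mathbf{1}$; $\Delta_G(\Gamma)=\sum_{V_1\sqcup V_2=V(\Gamma)}\Gamma[V_1]\otimes\Gamma[V_2]$ for $\Gamma\in\mathcal{G}$; and $\Delta_G(\Gamma_1\cdots\Gamma_n)=\Delta_G(\Gamma_1)\cdots\Delta_G(\Gamma_n)$ for $n\ge2$ and $\Gamma_1,\dots,\Gamma_n\in\mathcal{G}$.
   Context: $\mathbf{k}$ is a unitary commutative ring; tensor products and linear maps are over $\mathbf{k}$. Graphs are connected and undirected, without multiple edges and loops (induced subgraphs of them may be disconnected). $G$ is a graph with vertices labelled by natural numbers, the labels distinguishing the vertices from one another. $\mathcal{G}$ is the set of nonempty connected subgraphs of $G$ (a subgraph is a graph all of whose vertices lie in $V(G)$ and all of whose edges lie in $E(G)$). $M(\mathcal{G})$ is the free (noncommutative) monoid on $\mathcal{G}$, with multiplication given by concatenation and unit the empty graph $\mathbf{1}$. $H(\mathcal{G})=\mathbf{k}M(\mathcal{G})$ is the free $\mathbf{k}$-module on $M(\mathcal{G})$, with multiplication extended linearly. For $\Gamma\in\mathcal{G}$ and $U\subseteq V(\Gamma)$, $\Gamma[U]$ is the subgraph of $\Gamma$ induced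 by $U$, regarded as an element of $M(\mathcal{G})$, i.e. as a product of its connected components (no order of the factors is specified); $\Gamma[\emptyset]$ is the empty graph $\mathbf{1}$. Sums over $V_1\sqcup V_2=V(\Gamma)$ run over ordered pairs of disjoint subsets with union $V(\Gamma)$. For $F=\Gamma_1\cdots\Gamma_n\in M(\mathcal{G})$ with $\Gamma_i\in\mathcal{G}$, $V(F)$ is the multiset of vertices of $F$. The notation $U\uplus V=V(F)$ means that $U=U_1\cup\cdots\cup U_n$ and $V=V_1\cup\cdots\cup V_n$ with $U_i\sqcup V_i=V(\Gamma_i)$ for $i=1,\dots,n$; the sum is over all such choices of $(U_i,V_i)_{i}$, and $F[U]=\Gamma_1[U_1]\cdots\Gamma_n[U_n]$, $F[V]=\Gamma_1[V_1]\cdots\Gamma_n[V_n]$. *)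

theory Defs
  imports Complex_Main "HOL-Library.Poly_Mapping" "HOL-Library.Product_Plus" "HOL-Library.FuncSet"
begin

section \<open>Graphs\<close>

datatype ugraph = Graph (verts: "nat set") (edges: "nat set set")

definition simple_graph :: "ugraph \<Rightarrow> bool" where
  "simple_graph G \<longleftrightarrow> (\<forall>e \<in> edges G. e \<subseteq> verts G \<and> card e = 2)"

definition adj :: "ugraph \<Rightarrow> (nat \<times> nat) set" where
  "adj G = {(u, v). {u, v} \<in> edges G}"

text \<open>The graph without vertices is connected in this sense.\<close>

definition connected_graph :: "ugraph \<Rightarrow> bool" where
  "connected_graph G \<longleftrightarrow> (\<forall>u \<in> verts G. \<forall>v \<in> verts G. (u, v) \<in> (adj G)\<^sup>*)"

definition subgraph :: "ugraph \<Rightarrow> ugraph \<Rightarrow> bool" where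
  "subgraph H G \<longleftrightarrow> simple_graph H \<and> verts H \<subseteq> verts G \<and> edges H \<subseteq> edges G"

definition induced :: "ugraph \<Rightarrow> nat set \<Rightarrow> ugraph" where
  "induced G U = Graph U {e \<in> edges G. e \<subseteq> U}"

definition components :: "ugraph \<Rightarrow> ugraph set" where
  "components G = (\<lambda>v. induced G ((adj G)\<^sup>* `` {v})) ` verts G"

text \<open>
  The set of nonempty connected subgraphs of \<open>G\<close>. Its members are finite, so that the sums over
  subsets of their vertex sets make sense; \<open>G\<close> itself may be finite or infinite, and
  for finite \<open>G\<close> the finiteness condition is void.
\<close>

definition conn_subgraphs :: "ugraph \<Rightarrow> ugraph set" where
  "conn_subgraphs G =
     {\<Gamma>. subgraph \<Gamma> G \<and> finite (verts \<Gamma>) \<and> verts \<Gamma> \<noteq> {} \<and> connected_graph \<Gamma>}"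

text \<open>
  To view a disconnected graph as a word in its connected components one has to choose an order
  of the components. Such a choice is a function \<open>ord\<close> that lists the components of every finite
  subgraph of \<open>G\<close>, each of them once.
\<close>

definition component_order :: "ugraph \<Rightarrow> (ugraph \<Rightarrow> ugraph list) \<Rightarrow> bool" where
  "component_order G ord \<longleftrightarrow>
     (\<forall>H. subgraph H G \<and> finite (verts H) \<longrightarrow> distinct (ord H) \<and> set (ord H) = components H)"


section \<open>Words, the algebra of words and its tensor square\<close>

text \<open>
  The free monoid. It is written additively, because \<^typ>\<open>'a \<Rightarrow>\<^sub>0 'b\<close> carries the convolution
  product (the product of the monoid algebra) for additively written monoids \<open>'a\<close>. The
  addition is concatenation and is not commutative.
\<close>

datatype 'a word = Word (letters: "'a list")

instantiation word :: (type) monoid_add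
begin

definition zero_word :: "'a word" where
  "zero_word = Word []"

definition plus_word :: "'a word \<Rightarrow> 'a word \<Rightarrow> 'a word" where
  "plus_word v w = Word (letters v @ letters w)"

instance
  by standard (simp_all add: zero_word_def plus_word_def)

end

definition smul :: "'k::comm_ring_1 \<Rightarrow> ('a \<Rightarrow>\<^sub>0 'k) \<Rightarrow> ('a \<Rightarrow>\<^sub>0 'k)" where
  "smul c x = Poly_Mapping.map ((*) c) x"

definition basis :: "'a \<Rightarrow> ('a \<Rightarrow>\<^sub>0 'k::comm_ring_1)" where
  "basis a = Poly_Mapping.single a 1"

definition free_on :: "'a set \<Rightarrow> ('a \<Rightarrow>\<^sub>0 'k::comm_ring_1) set" where
  "free_on A = {x. Poly_Mapping.keys x \<subseteq> A}"

definition linear_on ::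
    "('a \<Rightarrow>\<^sub>0 'k::comm_ring_1) set \<Rightarrow> ('b \<Rightarrow>\<^sub>0 'k) set \<Rightarrow> (('a \<Rightarrow>\<^sub>0 'k) \<Rightarrow> ('b \<Rightarrow>\<^sub>0 'k)) \<Rightarrow> bool" where
  "linear_on S T f \<longleftrightarrow>
     f \<in> S \<rightarrow> T \<and>
     (\<forall>x \<in> S. \<forall>y \<in> S. f (x + y) = f x + f y) \<and>
     (\<forall>c. \<forall>x \<in> S. f (smul c x) = smul c (f x))"

text \<open>
  The tensor product of the free modules on \<open>A\<close> and \<open>B\<close> is realised as the free module on
  \<open>A \<times> B\<close>; the universal property is proved below. If \<open>A\<close> and \<open>B\<close> are monoids, the convolution
  product over the product monoid is the usual product of the tensor product of algebras.
\<close>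

definition tensor :: "('a \<Rightarrow>\<^sub>0 'k::comm_ring_1) \<Rightarrow> ('b \<Rightarrow>\<^sub>0 'k) \<Rightarrow> ('a \<times> 'b \<Rightarrow>\<^sub>0 'k)"
    (infixr "\<otimes>\<^sub>k" 75) where
  "x \<otimes>\<^sub>k y = (\<Sum>a \<in> Poly_Mapping.keys x. \<Sum>b \<in> Poly_Mapping.keys y.
     Poly_Mapping.single (a, b) (Poly_Mapping.lookup x a * Poly_Mapping.lookup y b))"

lemma lookup_smul [simp]: "Poly_Mapping.lookup (smul c x) a = c * Poly_Mapping.lookup x a"
  by (simp add: smul_def map.rep_eq when_def)

lemma keys_smul: "Poly_Mapping.keys (smul c x) \<subseteq> Poly_Mapping.keys x"
  by (auto simp: in_keys_iff)

lemma lookup_tensor [simp]: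
  "Poly_Mapping.lookup (x \<otimes>\<^sub>k y) (a, b) = Poly_Mapping.lookup x a * Poly_Mapping.lookup y b"
proof -
  let ?X = "Poly_Mapping.lookup x" and ?Y = "Poly_Mapping.lookup y"
  have "Poly_Mapping.lookup (x \<otimes>\<^sub>k y) (a, b) =
      (\<Sum>a' \<in> Poly_Mapping.keys x. \<Sum>b' \<in> Poly_Mapping.keys y.
         if a' = a then if b' = b then ?X a' * ?Y b' else 0 else 0)"
    by (auto simp: tensor_def lookup_sum lookup_single when_def intro!: sum.cong)
  also have "\<dots> = (\<Sum>a' \<in> Poly_Mapping.keys x. if a' = a then
      (\<Sum>b' \<in> Poly_Mapping.keys y. if b' = b then ?X a' * ?Y b' else 0) else 0)"
    by (intro sum.cong) auto
  also have "\<dots> = ?X a * ?Y b"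
    by (simp add: in_keys_iff)
  finally show ?thesis .
qed

lemma keys_tensor: "Poly_Mapping.keys (x \<otimes>\<^sub>k y) \<subseteq> Poly_Mapping.keys x \<times> Poly_Mapping.keys y"
  by (auto simp: in_keys_iff)

lemma tensor_basis: "basis a \<otimes>\<^sub>k basis b = basis (a, b)"
  by (rule poly_mapping_eqI) (auto simp: basis_def lookup_single when_def split: if_splits)

lemma tensor_bilinear:
  "(x + x') \<otimes>\<^sub>k y = x \<otimes>\<^sub>k y + x' \<otimes>\<^sub>k y"
  "x \<otimes>\<^sub>k (y + y') = x \<otimes>\<^sub>k y + x \<otimes>\<^sub>k y'"
  "smul c x \<otimes>\<^sub>k y = smul c (x \<otimes>\<^sub>k y)"
  "x \<otimes>\<^sub>k smul c y = smul c (x \<otimes>\<^sub>k y)"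
  by (rule poly_mapping_eqI; auto simp: lookup_add algebra_simps)+

lemma free_on_expand:
  "x = (\<Sum>a \<in> Poly_Mapping.keys x. smul (Poly_Mapping.lookup x a) (basis a))"
  by (rule poly_mapping_eqI)
     (simp add: lookup_sum basis_def lookup_single when_def if_distrib in_keys_iff cong: if_cong)

lemma free_on_closed:
  "0 \<in> free_on A"
  "x \<in> free_on A \<Longrightarrow> y \<in> free_on A \<Longrightarrow> x + y \<in> free_on A"
  "x \<in> free_on A \<Longrightarrow> smul c x \<in> free_on A"
  "a \<in> A \<Longrightarrow> basis a \<in> free_on A"
  using keys_add[of x y] keys_smul[of c x] by (auto simp: free_on_def basis_def)

lemma free_on_sum: "(\<And>i. i \<in> I \<Longrightarrow> f i \<in> free_on A) \<Longrightarrow> sum f I \<in> free_on A"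
  by (induction I rule: infinite_finite_induct) (auto intro: free_on_closed)

lemma additive_sum_on_free:
  fixes \<phi> :: "('a \<Rightarrow>\<^sub>0 'k::comm_ring_1) \<Rightarrow> 'm::ab_group_add"
  assumes "\<And>x y. x \<in> free_on A \<Longrightarrow> y \<in> free_on A \<Longrightarrow> \<phi> (x + y) = \<phi> x + \<phi> y"
    and "finite I" "\<And>i. i \<in> I \<Longrightarrow> f i \<in> free_on A"
  shows "\<phi> (sum f I) = (\<Sum>i \<in> I. \<phi> (f i))"
  using assms(2,3)
proof (induction I rule: finite_induct)
  case empty
  show ?case using assms(1)[of 0 0] by (simp add: free_on_closed)
next
  case (insert i I)
  then show ?case by (simp add: assms(1) free_on_sum)
qed

theorem tensor_universal_property:
  fixes scale :: "'k::comm_ring_1 \<Rightarrow> 'm::ab_group_add \<Rightarrow> 'm"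
    and \<beta> :: "('a \<Rightarrow>\<^sub>0 'k) \<Rightarrow> ('b \<Rightarrow>\<^sub>0 'k) \<Rightarrow> 'm"
  assumes "module scale"
    and add_left: "\<And>x x' y. x \<in> free_on A \<Longrightarrow> x' \<in> free_on A \<Longrightarrow> y \<in> free_on B \<Longrightarrow> \<beta> (x + x') y = \<beta> x y + \<beta> x' y"
    and add_right: "\<And>x y y'. x \<in> free_on A \<Longrightarrow> y \<in> free_on B \<Longrightarrow> y' \<in> free_on B \<Longrightarrow> \<beta> x (y + y') = \<beta> x y + \<beta> x y'"
    and scale_left: "\<And>c x y. x \<in> free_on A \<Longrightarrow> y \<in> free_on B \<Longrightarrow> \<beta> (smul c x) y = scale c (\<beta> x y)"
    and scale_right: "\<And>c x y. x \<in> free_on A \<Longrightarrow> y \<in> free_on B \<Longrightarrow> \<beta> x (smul c y) = scale c (\<beta> x y)"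
  defines "factors \<equiv> \<lambda>\<phi>.
      (\<forall>s \<in> free_on (A \<times> B). \<forall>t \<in> free_on (A \<times> B). \<phi> (s + t) = \<phi> s + \<phi> t) \<and>
      (\<forall>c. \<forall>t \<in> free_on (A \<times> B). \<phi> (smul c t) = scale c (\<phi> t)) \<and>
      (\<forall>x \<in> free_on A. \<forall>y \<in> free_on B. \<phi> (x \<otimes>\<^sub>k y) = \<beta> x y)"
  shows "\<exists>\<phi>. factors \<phi> \<and> (\<forall>\<psi>. factors \<psi> \<longrightarrow> (\<forall>t \<in> free_on (A \<times> B). \<psi> t = \<phi> t))"
proof -
  interpret module scale by fact
  define b where "b = (\<lambda>p. \<beta> (basis (fst p)) (basis (snd p)))"
  define \<phi> where "\<phi> = (\<lambda>t. \<Sum>p \<in> Poly_Mapping.keys t. scale (Poly_Mapping.lookup t p) (b p))"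
  have \<phi>_superset: "\<phi> t = (\<Sum>p \<in> P. scale (Poly_Mapping.lookup t p) (b p))"
    if "finite P" "Poly_Mapping.keys t \<subseteq> P" for t P
    unfolding \<phi>_def using that
    by (intro sum.mono_neutral_left) (auto simp: in_keys_iff)
  have \<phi>_add: "\<phi> (s + t) = \<phi> s + \<phi> t" for s t
  proof -
    let ?P = "Poly_Mapping.keys s \<union> Poly_Mapping.keys t"
    have "finite ?P" by simp
    then show ?thesis
      using \<phi>_superset[of ?P s] \<phi>_superset[of ?P t] \<phi>_superset[of ?P "s + t"] keys_add[of s t]
      by (simp add: lookup_add scale_left_distrib sum.distrib)
  qed
  have \<phi>_smul: "\<phi> (smul c t) = scale c (\<phi> t)" for c t
    using \<phi>_superset[of "Poly_Mapping.keys t" "smul c t"] keys_smul[of c t]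
    by (simp add: \<phi>_def scale_sum_right)
  have \<phi>_tensor: "\<phi> (x \<otimes>\<^sub>k y) = \<beta> x y" if x: "x \<in> free_on A" and y: "y \<in> free_on B" for x y
  proof -
    have bx: "basis a \<in> free_on A" if "a \<in> Poly_Mapping.keys x" for a
      using that x by (auto simp: free_on_def basis_def)
    have by': "basis a \<in> free_on B" if "a \<in> Poly_Mapping.keys y" for a
      using that y by (auto simp: free_on_def basis_def)
    have "\<beta> x y = \<beta> (\<Sum>a \<in> Poly_Mapping.keys x. smul (Poly_Mapping.lookup x a) (basis a)) y"
      using free_on_expand[of x] by simp
    also have "\<dots> = (\<Sum>a \<in> Poly_Mapping.keys x. \<beta> (smul (Poly_Mapping.lookup x a) (basis a)) y)"
      by (rule additive_sum_on_free[where A = A and \<phi> = "\<lambda>x. \<beta> x y"])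
         (auto intro: add_left y free_on_closed bx)
    also have "\<dots> = (\<Sum>a \<in> Poly_Mapping.keys x. scale (Poly_Mapping.lookup x a) (\<beta> (basis a) y))"
      by (intro sum.cong) (auto intro: scale_left bx y)
    also have "\<dots> = (\<Sum>a \<in> Poly_Mapping.keys x. scale (Poly_Mapping.lookup x a)
        (\<Sum>a' \<in> Poly_Mapping.keys y. scale (Poly_Mapping.lookup y a') (b (a, a'))))"
    proof (intro sum.cong refl arg_cong[where f = "scale _"])
      fix a assume a: "a \<in> Poly_Mapping.keys x"
      have "\<beta> (basis a) y =
          \<beta> (basis a) (\<Sum>a' \<in> Poly_Mapping.keys y. smul (Poly_Mapping.lookup y a') (basis a'))"
        using free_on_expand[of y] by simp
      also have "\<dots> = (\<Sum>a' \<in> Poly_Mapping.keys y.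
          \<beta> (basis a) (smul (Poly_Mapping.lookup y a') (basis a')))"
        by (rule additive_sum_on_free[where A = B])
           (auto intro: add_right free_on_closed bx[OF a] by')
      also have "\<dots> = (\<Sum>a' \<in> Poly_Mapping.keys y. scale (Poly_Mapping.lookup y a') (b (a, a')))"
        unfolding b_def by (intro sum.cong) (auto intro: scale_right bx[OF a] by')
      finally show "\<beta> (basis a) y =
        (\<Sum>a' \<in> Poly_Mapping.keys y. scale (Poly_Mapping.lookup y a') (b (a, a')))" .
    qed
    also have "\<dots> = (\<Sum>p \<in> Poly_Mapping.keys x \<times> Poly_Mapping.keys y.
        scale (Poly_Mapping.lookup (x \<otimes>\<^sub>k y) p) (b p))"
      by (simp add: scale_sum_right sum.cartesian_product case_prod_unfold flip: lookup_tensor)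
    also have "\<dots> = \<phi> (x \<otimes>\<^sub>k y)"
      by (rule \<phi>_superset[symmetric]) (auto dest: subsetD[OF keys_tensor])
    finally show ?thesis by simp
  qed
  have "factors \<phi>"
    by (simp add: factors_def \<phi>_add \<phi>_smul \<phi>_tensor)
  moreover have "\<psi> t = \<phi> t" if \<psi>: "factors \<psi>" and t: "t \<in> free_on (A \<times> B)" for \<psi> t
  proof -
    have bt: "basis p \<in> free_on (A \<times> B)" if "p \<in> Poly_Mapping.keys t" for p
      using that t by (auto simp: free_on_def basis_def)
    have "\<psi> t = \<psi> (\<Sum>p \<in> Poly_Mapping.keys t. smul (Poly_Mapping.lookup t p) (basis p))"
      using free_on_expand[of t] by simp
    also have "\<dots> = (\<Sum>p \<in> Poly_Mapping.keys t. \<psi> (smul (Poly_Mapping.lookup t p) (basis p)))"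
      using \<psi> by (intro additive_sum_on_free[where A = "A \<times> B"])
        (auto simp: factors_def intro: free_on_closed bt)
    also have "\<dots> = \<phi> t"
      unfolding \<phi>_def
    proof (intro sum.cong refl)
      fix p assume p: "p \<in> Poly_Mapping.keys t"
      obtain a a' where [simp]: "p = (a, a')" by (cases p)
      have "a \<in> A" "a' \<in> B" using p t by (auto simp: free_on_def)
      then have "\<psi> (basis p) = b p"
        using \<psi> by (simp add: factors_def b_def free_on_closed flip: tensor_basis)
      then show "\<psi> (smul (Poly_Mapping.lookup t p) (basis p)) = scale (Poly_Mapping.lookup t p) (b p)"
        using \<psi> bt[OF p] unfolding factors_def by metis
    qed
    finally show ?thesis .
  qed
  ultimately show ?thesis by blast
qed

lemma basis_mult: "(basis a :: 'a::monoid_add \<Rightarrow>\<^sub>0 'k::comm_ring_1) * basis b = basis (a + b)"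
  by (simp add: basis_def mult_single)

lemma tensor_mult_basis:
  fixes a a' b b' :: "'a::monoid_add"
  shows "(basis a \<otimes>\<^sub>k basis b :: 'a \<times> 'a \<Rightarrow>\<^sub>0 'k::comm_ring_1) * (basis a' \<otimes>\<^sub>k basis b') =
    (basis a * basis a') \<otimes>\<^sub>k (basis b * basis b')"
  by (simp add: tensor_basis basis_mult)


section \<open>The two coproducts\<close>

definition monoid_of :: "ugraph \<Rightarrow> ugraph word set" where
  "monoid_of G = {F. set (letters F) \<subseteq> conn_subgraphs G}"

definition alg :: "ugraph \<Rightarrow> (ugraph word \<Rightarrow>\<^sub>0 'k::comm_ring_1) set" where
  "alg G = free_on (monoid_of G)"

definition alg2 :: "ugraph \<Rightarrow> (ugraph word \<times> ugraph word \<Rightarrow>\<^sub>0 'k::comm_ring_1) set" where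
  "alg2 G = free_on (monoid_of G \<times> monoid_of G)"

text \<open>\<open>\<Gamma>[U]\<close> as a word.\<close>

definition ind_word :: "(ugraph \<Rightarrow> ugraph list) \<Rightarrow> ugraph \<Rightarrow> nat set \<Rightarrow> ugraph word" where
  "ind_word ord \<Gamma> U = Word (ord (induced \<Gamma> U))"

definition splits :: "ugraph \<Rightarrow> (nat set \<times> nat set) set" where
  "splits \<Gamma> = {(U, V). U \<union> V = verts \<Gamma> \<and> U \<inter> V = {}}"

definition is_coproduct ::
    "ugraph \<Rightarrow> (ugraph \<Rightarrow> ugraph list) \<Rightarrow>
     ((ugraph word \<Rightarrow>\<^sub>0 'k::comm_ring_1) \<Rightarrow> (ugraph word \<times> ugraph word \<Rightarrow>\<^sub>0 'k)) \<Rightarrow> bool" where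
  "is_coproduct G ord D \<longleftrightarrow>
     linear_on (alg G) (alg2 G) D \<and>
     D (basis (Word [])) = basis (Word []) \<otimes>\<^sub>k basis (Word []) \<and>
     (\<forall>\<Gamma> \<in> conn_subgraphs G. D (basis (Word [\<Gamma>])) =
        (\<Sum>(V1, V2) \<in> splits \<Gamma>. basis (ind_word ord \<Gamma> V1) \<otimes>\<^sub>k basis (ind_word ord \<Gamma> V2))) \<and>
     (\<forall>\<Gamma>s. length \<Gamma>s \<ge> 2 \<and> set \<Gamma>s \<subseteq> conn_subgraphs G \<longrightarrow>
        D (basis (Word \<Gamma>s)) = prod_list (map (\<lambda>\<Gamma>. D (basis (Word [\<Gamma>]))) \<Gamma>s))"

text \<open>
  The index set of the sum over \<open>U \<uplus> V = V(F)\<close>: families \<open>(U\<^sub>i, V\<^sub>i)\<^sub>i\<close> with one split for each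
  letter of \<open>F\<close>.
\<close>

definition word_splits :: "ugraph word \<Rightarrow> (nat set \<times> nat set) list set" where
  "word_splits F = {ps. list_all2 (\<lambda>p \<Gamma>. p \<in> splits \<Gamma>) ps (letters F)}"

text \<open>\<open>F[U] = \<Gamma>\<^sub>1[U\<^sub>1] \<dots> \<Gamma>\<^sub>n[U\<^sub>n]\<close>; the product of words is \<^term>\<open>(+)\<close>.\<close>

definition restrict_word :: "(ugraph \<Rightarrow> ugraph list) \<Rightarrow> ugraph word \<Rightarrow> nat set list \<Rightarrow> ugraph word" where
  "restrict_word ord F Us = sum_list (map2 (ind_word ord) (letters F) Us)"

text \<open>The linear extension of the combinatorial formula on words.\<close>

definition comb_coproduct ::
    "(ugraph \<Rightarrow> ugraph list) \<Rightarrow> (ugraph word \<Rightarrow>\<^sub>0 'k::comm_ring_1) \<Rightarrow>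
     (ugraph word \<times> ugraph word \<Rightarrow>\<^sub>0 'k)" where
  "comb_coproduct ord x =
     (\<Sum>F \<in> Poly_Mapping.keys x. smul (Poly_Mapping.lookup x F)
        (\<Sum>ps \<in> word_splits F.
           basis (restrict_word ord F (map fst ps)) \<otimes>\<^sub>k basis (restrict_word ord F (map snd ps))))"

end

theory Submission
  imports Defs
begin

text \<open>
  A splitting of the word \<open>\<Gamma>\<^sub>1 \<dots> \<Gamma>\<^sub>n\<close> is a splitting of \<open>\<Gamma>\<^sub>1\<close> followed by a splitting of
  \<open>\<Gamma>\<^sub>2 \<dots> \<Gamma>\<^sub>n\<close>, so distributivity turns the combinatorial sum for the word into the product of
  the sums for its letters. Conversely, the three rules fix a linear map on the basis of words.
\<close>

section \<open>Components of finite subgraphs as letters\<close>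

lemma induced_subgraph:
  assumes "subgraph H G" and "U \<subseteq> verts H"
  shows "subgraph (induced H U) G"
  using assms by (auto simp: subgraph_def simple_graph_def induced_def)

lemma sym_adj: "sym (adj G)"
  by (auto simp: sym_def adj_def insert_commute)

text \<open>\<open>induced\<close> takes the given set as its vertex set without intersecting it
  with the vertices of the graph, so components stay inside the graph only by this closure.\<close>

lemma adj_rtrancl_in_verts:
  assumes "simple_graph G" and "(v, w) \<in> (adj G)\<^sup>*" and "v \<in> verts G"
  shows "w \<in> verts G"
  using assms(2,3,1) by (induction rule: rtrancl_induct) (auto simp: simple_graph_def adj_def)

text \<open>A walk from \<open>v\<close> visits only vertices reachable from \<open>v\<close>, so
  all its edges survive in \<open>?C\<close>. By symmetry any two vertices of \<open>?C\<close> are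
  joined through \<open>v\<close>.\<close>

lemma connected_component:
  "connected_graph (induced G ((adj G)\<^sup>* `` {v}))" (is "connected_graph ?C")
proof -
  have "sym ((adj ?C)\<^sup>*)"
    by (intro sym_rtrancl sym_adj)
  have reach: "(v, w) \<in> (adj ?C)\<^sup>*" if "(v, w) \<in> (adj G)\<^sup>*" for w
    using that
  proof (induction rule: rtrancl_induct)
    case (step y z)
    then have "(v, z) \<in> (adj G)\<^sup>*"
      by (simp add: rtrancl.rtrancl_into_rtrancl)
    with step.hyps have "(y, z) \<in> adj ?C"
      by (auto simp: adj_def induced_def)
    with step.IH show ?case by simp
  qed simp
  show ?thesis
    unfolding connected_graph_def
  proof (intro ballI)
    fix u w assume "u \<in> verts ?C" "w \<in> verts ?C"
    then have "(v, u) \<in> (adj G)\<^sup>*" "(v, w) \<in> (adj G)\<^sup>*"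
      by (auto simp: induced_def)
    then have "(v, u) \<in> (adj ?C)\<^sup>*" "(v, w) \<in> (adj ?C)\<^sup>*"
      by (simp_all only: reach)
    with \<open>sym ((adj ?C)\<^sup>*)\<close> show "(u, w) \<in> (adj ?C)\<^sup>*"
      by (meson rtrancl_trans symD)
  qed
qed

lemma components_conn_subgraphs:
  assumes "subgraph H G" and "finite (verts H)"
  shows "components H \<subseteq> conn_subgraphs G"
proof
  fix C assume "C \<in> components H"
  then obtain v where v: "v \<in> verts H" and C: "C = induced H ((adj H)\<^sup>* `` {v})"
    by (auto simp: components_def)
  have sub: "(adj H)\<^sup>* `` {v} \<subseteq> verts H"
    using assms(1) v by (auto simp: subgraph_def intro: adj_rtrancl_in_verts)
  have "verts C = (adj H)\<^sup>* `` {v}"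
    by (simp add: C induced_def)
  then have "finite (verts C)" "verts C \<noteq> {}"
    using finite_subset[OF sub assms(2)] by auto
  moreover have "subgraph C G"
    unfolding C by (rule induced_subgraph[OF assms(1) sub])
  moreover have "connected_graph C"
    unfolding C by (rule connected_component)
  ultimately show "C \<in> conn_subgraphs G"
    by (simp add: conn_subgraphs_def)
qed

text \<open>\<open>component_order\<close> speaks only of finite subgraphs of \<open>G\<close>; the
  induced graph is one because \<open>\<Gamma>\<close> is, and then its components are
  letters.\<close>

lemma ind_word_in_monoid_of:
  assumes "component_order G ord" and "\<Gamma> \<in> conn_subgraphs G" and "U \<subseteq> verts \<Gamma>"
  shows "ind_word ord \<Gamma> U \<in> monoid_of G"
proof -
  have "subgraph (induced \<Gamma> U) G"
    using assms(2,3) by (auto simp: conn_subgraphs_def intro: induced_subgraph)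
  moreover have "finite (verts (induced \<Gamma> U))"
    using assms(2,3) by (auto simp: conn_subgraphs_def induced_def intro: finite_subset)
  ultimately show ?thesis
    using assms(1) components_conn_subgraphs
    by (auto simp: component_order_def monoid_of_def ind_word_def)
qed

section \<open>Splittings and restrictions of words, letter by letter\<close>

lemma word_splits_Nil: "word_splits (Word []) = {[]}"
  by (simp add: word_splits_def)

lemma word_splits_Cons:
  "word_splits (Word (\<Gamma> # \<Gamma>s)) = (\<lambda>(p, ps). p # ps) ` (splits \<Gamma> \<times> word_splits (Word \<Gamma>s))"
  by (auto simp: word_splits_def list_all2_Cons2)

lemma restrict_word_Nil: "restrict_word ord (Word []) [] = Word []"
  by (simp add: restrict_word_def zero_word_def)

lemma restrict_word_Cons:
  "restrict_word ord (Word (\<Gamma> # \<Gamma>s)) (U # Us) =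
     ind_word ord \<Gamma> U + restrict_word ord (Word \<Gamma>s) Us"
  by (simp add: restrict_word_def)

lemma plus_in_monoid_of:
  "v \<in> monoid_of G \<Longrightarrow> w \<in> monoid_of G \<Longrightarrow> v + w \<in> monoid_of G"
  by (simp add: monoid_of_def plus_word_def)

lemma restrict_word_in_monoid_of:
  assumes "component_order G ord" and "set \<Gamma>s \<subseteq> conn_subgraphs G"
    and "ps \<in> word_splits (Word \<Gamma>s)"
  shows "restrict_word ord (Word \<Gamma>s) (map fst ps) \<in> monoid_of G \<and>
    restrict_word ord (Word \<Gamma>s) (map snd ps) \<in> monoid_of G"
  using assms(2,3)
proof (induction \<Gamma>s arbitrary: ps)
  case Nil
  then show ?case
    by (simp add: word_splits_Nil restrict_word_Nil monoid_of_def)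
next
  case (Cons \<Gamma> \<Gamma>s)
  then obtain p qs where ps: "ps = p # qs" and "p \<in> splits \<Gamma>" "qs \<in> word_splits (Word \<Gamma>s)"
    by (auto simp: word_splits_Cons)
  moreover from \<open>p \<in> splits \<Gamma>\<close> have "fst p \<subseteq> verts \<Gamma>" "snd p \<subseteq> verts \<Gamma>"
    by (auto simp: splits_def)
  ultimately show ?case
    using Cons assms(1)
    by (auto simp: restrict_word_Cons intro!: plus_in_monoid_of ind_word_in_monoid_of)
qed

section \<open>The linear extension of the combinatorial formula\<close>

definition split_sum ::
    "(ugraph \<Rightarrow> ugraph list) \<Rightarrow> ugraph word \<Rightarrow> (ugraph word \<times> ugraph word \<Rightarrow>\<^sub>0 'k::comm_ring_1)"
  where
  "split_sum ord F = (\<Sum>ps \<in> word_splits F.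
     basis (restrict_word ord F (map fst ps)) \<otimes>\<^sub>k basis (restrict_word ord F (map snd ps)))"

text \<open>Coefficients outside the keys vanish. The defining sum depends on the keys of
  \<open>x\<close>, which addition and scaling change; a common index set makes such sums
  comparable.\<close>

lemma comb_coproduct_superset:
  assumes "finite A" and "Poly_Mapping.keys x \<subseteq> A"
  shows "comb_coproduct ord x = (\<Sum>F \<in> A. smul (Poly_Mapping.lookup x F) (split_sum ord F))"
  unfolding comb_coproduct_def split_sum_def[symmetric]
  using assms
  by (intro sum.mono_neutral_left) (auto simp: in_keys_iff intro!: poly_mapping_eqI)

lemma smul_add_left: "smul (a + b) x = smul a x + smul b x"
  by (rule poly_mapping_eqI) (simp add: lookup_add algebra_simps)

lemma smul_mult: "smul (a * b) x = smul a (smul b x)"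
  by (rule poly_mapping_eqI) (simp add: algebra_simps)

lemma smul_sum: "smul a (sum f A) = (\<Sum>i \<in> A. smul a (f i))"
  by (rule poly_mapping_eqI) (simp add: lookup_sum sum_distrib_left)

lemma smul_one: "smul 1 x = x"
  by (rule poly_mapping_eqI) simp

lemma comb_coproduct_add:
  "comb_coproduct ord (x + y) = comb_coproduct ord x + comb_coproduct ord y"
proof -
  \<comment> \<open>Cancellation may remove keys from \<open>x + y\<close>; the union covers all
    three key sets.\<close>
  let ?A = "Poly_Mapping.keys x \<union> Poly_Mapping.keys y"
  have "finite ?A" by simp
  then show ?thesis
    using comb_coproduct_superset[of ?A x ord] comb_coproduct_superset[of ?A y ord]
      comb_coproduct_superset[of ?A "x + y" ord] keys_add[of x y]
    by (simp add: lookup_add smul_add_left sum.distrib)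
qed

text \<open>Zero divisors may make the keys of \<open>smul c x\<close> fewer, so both sums run over
  the keys of \<open>x\<close>.\<close>

lemma comb_coproduct_smul: "comb_coproduct ord (smul c x) = smul c (comb_coproduct ord x)"
  using comb_coproduct_superset[of "Poly_Mapping.keys x" "smul c x" ord] keys_smul[of c x]
    comb_coproduct_superset[of "Poly_Mapping.keys x" x ord]
  by (simp add: smul_sum smul_mult)

lemma comb_coproduct_basis: "comb_coproduct ord (basis F) = split_sum ord F"
  using comb_coproduct_superset[of "{F}" "basis F" ord]
  by (simp add: basis_def smul_one)

lemma linear_comb_coproduct:
  assumes "component_order G ord"
  shows "linear_on (alg G) (alg2 G) (comb_coproduct ord)"
proof -
  have "split_sum ord F \<in> alg2 G" if "F \<in> monoid_of G" for F
    using that assms restrict_word_in_monoid_of[of G ord "letters F"]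
    unfolding split_sum_def alg2_def
    by (auto simp: tensor_basis monoid_of_def intro!: free_on_sum free_on_closed)
  then have "comb_coproduct ord x \<in> alg2 G" if "x \<in> alg G" for x
    using that unfolding comb_coproduct_superset[OF finite_keys order_refl] alg2_def
    by (auto simp: alg_def free_on_def[of "monoid_of G"] intro!: free_on_sum free_on_closed)
  then show ?thesis
    by (auto simp: linear_on_def comb_coproduct_add comb_coproduct_smul)
qed

section \<open>Multiplicativity of the combinatorial sum\<close>

lemma split_sum_Nil: "split_sum ord (Word []) = basis (Word []) \<otimes>\<^sub>k basis (Word [])"
  by (simp add: split_sum_def word_splits_Nil restrict_word_Nil)

text \<open>The pair of empty words is the zero of the additively written product monoid, hence the
  unit for convolution. This matches the rule for the empty graph with the empty product.\<close>

lemma basis_Word_Nil: "basis (Word []) \<otimes>\<^sub>k basis (Word []) = 1"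
  unfolding tensor_basis by (simp add: basis_def zero_prod_def zero_word_def flip: single_one)

text \<open>Basis tensors multiply by concatenation in each factor, so expanding the product gives
  one term per pair of a split of \<open>\<Gamma>\<close> and a splitting of the rest. If
  \<open>splits \<Gamma>\<close> is infinite, both sides are 0 by the convention for infinite
  sums.\<close>

lemma split_sum_Cons:
  "split_sum ord (Word (\<Gamma> # \<Gamma>s)) =
     (\<Sum>(U, V) \<in> splits \<Gamma>. basis (ind_word ord \<Gamma> U) \<otimes>\<^sub>k basis (ind_word ord \<Gamma> V)) *
     split_sum ord (Word \<Gamma>s)"
proof -
  \<comment> \<open>No splitting arises from two pairs, so the sum can be reindexed.\<close>
  have "inj_on (\<lambda>(p, ps). p # ps) (splits \<Gamma> \<times> word_splits (Word \<Gamma>s))"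
    by (auto simp: inj_on_def)
  then show ?thesis
    by (simp add: split_sum_def word_splits_Cons sum.reindex sum_product sum.cartesian_product
        case_prod_unfold restrict_word_Cons tensor_mult_basis basis_mult)
qed

lemma split_sum_single:
  "split_sum ord (Word [\<Gamma>]) =
     (\<Sum>(U, V) \<in> splits \<Gamma>. basis (ind_word ord \<Gamma> U) \<otimes>\<^sub>k basis (ind_word ord \<Gamma> V))"
  by (simp add: split_sum_Cons split_sum_Nil basis_Word_Nil)

text \<open>Iterating \<open>split_sum_Cons\<close> keeps the factors in the order of the letters,
  as the noncommutative product demands.\<close>

lemma split_sum_prod_list:
  "split_sum ord (Word \<Gamma>s) = prod_list (map (\<lambda>\<Gamma>. split_sum ord (Word [\<Gamma>])) \<Gamma>s)"
proof (induction \<Gamma>s)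
  case Nil
  show ?case by (simp add: split_sum_Nil basis_Word_Nil)
next
  case (Cons \<Gamma> \<Gamma>s)
  then show ?case
    by (simp add: split_sum_Cons[of ord \<Gamma> \<Gamma>s] split_sum_single)
qed

lemma is_coproduct_comb_coproduct:
  assumes "component_order G ord"
  shows "is_coproduct G ord (comb_coproduct ord)"
  unfolding is_coproduct_def comb_coproduct_basis
  using linear_comb_coproduct[OF assms] split_sum_Nil split_sum_single split_sum_prod_list
  by blast

section \<open>Uniqueness from the values on words\<close>

lemma linear_on_free_expand:
  assumes "linear_on (free_on A) T f" and "x \<in> free_on A"
  shows "f x = (\<Sum>a \<in> Poly_Mapping.keys x. smul (Poly_Mapping.lookup x a) (f (basis a)))"
proof -
  \<comment> \<open>\<open>f\<close> is linear only on \<open>free_on A\<close>, so every summand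
    must be known to lie there.\<close>
  have b: "basis a \<in> free_on A" if "a \<in> Poly_Mapping.keys x" for a
    using that assms(2) by (auto simp: free_on_def basis_def)
  have "f x = f (\<Sum>a \<in> Poly_Mapping.keys x. smul (Poly_Mapping.lookup x a) (basis a))"
    using free_on_expand[of x] by simp
  also have "\<dots> = (\<Sum>a \<in> Poly_Mapping.keys x. f (smul (Poly_Mapping.lookup x a) (basis a)))"
    using assms(1) by (intro additive_sum_on_free[where A = A])
      (auto simp: linear_on_def intro: free_on_closed b)
  also have "\<dots> = (\<Sum>a \<in> Poly_Mapping.keys x. smul (Poly_Mapping.lookup x a) (f (basis a)))"
    using assms(1) by (intro sum.cong) (auto simp: linear_on_def b)
  finally show ?thesis .
qed

lemma is_coproduct_basis:
  assumes D: "is_coproduct G ord D" and "set \<Gamma>s \<subseteq> conn_subgraphs G"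
  shows "D (basis (Word \<Gamma>s)) = split_sum ord (Word \<Gamma>s)"
proof -
  have single: "D (basis (Word [\<Gamma>])) = split_sum ord (Word [\<Gamma>])" if "\<Gamma> \<in> set \<Gamma>s" for \<Gamma>
    using that assms by (auto simp: is_coproduct_def split_sum_single)
  \<comment> \<open>One case for each of the three rules; the case rule of
    \<open>remdups_adj\<close> is borrowed for its list patterns.\<close>
  consider "\<Gamma>s = []" | \<Gamma> where "\<Gamma>s = [\<Gamma>]" | "length \<Gamma>s \<ge> 2"
    by (cases \<Gamma>s rule: remdups_adj.cases) auto
  then show ?thesis
  proof cases
    case 1
    then show ?thesis using D by (simp add: is_coproduct_def split_sum_Nil)
  next
    case 2
    then show ?thesis using single by simp
  next
    case 3
    then have "D (basis (Word \<Gamma>s)) = prod_list (map (\<lambda>\<Gamma>. D (basis (Word [\<Gamma>]))) \<Gamma>s)"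
      using assms by (auto simp: is_coproduct_def)
    also have "\<dots> = prod_list (map (\<lambda>\<Gamma>. split_sum ord (Word [\<Gamma>])) \<Gamma>s)"
      using single by (simp cong: map_cong)
    finally show ?thesis by (simp add: split_sum_prod_list[of ord \<Gamma>s])
  qed
qed

text \<open>The first conjunct shows that the rules are consistent, so the second is not vacuous.
  Equality is on \<open>alg G\<close>, since the rules leave \<open>D\<close> arbitrary
  elsewhere.\<close>

theorem proposition2p11:
  fixes G :: ugraph
    and ord :: "ugraph \<Rightarrow> ugraph list"
  assumes "simple_graph G"
    and "connected_graph G"
    and "component_order G ord"
  shows "is_coproduct G ord
           (comb_coproduct ord ::
             (ugraph word \<Rightarrow>\<^sub>0 'k::comm_ring_1) \<Rightarrow> (ugraph word \<times> ugraph word \<Rightarrow>\<^sub>0 'k)) \<and>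
         (\<forall>D :: (ugraph word \<Rightarrow>\<^sub>0 'k) \<Rightarrow> (ugraph word \<times> ugraph word \<Rightarrow>\<^sub>0 'k).
            is_coproduct G ord D \<longrightarrow> (\<forall>x \<in> alg G. D x = comb_coproduct ord x))"
proof (intro conjI allI impI ballI)
  show "is_coproduct G ord
      (comb_coproduct ord :: (ugraph word \<Rightarrow>\<^sub>0 'k) \<Rightarrow> (ugraph word \<times> ugraph word \<Rightarrow>\<^sub>0 'k))"
    by (rule is_coproduct_comb_coproduct[OF assms(3)])
next
  fix D :: "(ugraph word \<Rightarrow>\<^sub>0 'k) \<Rightarrow> (ugraph word \<times> ugraph word \<Rightarrow>\<^sub>0 'k)"
    and x :: "ugraph word \<Rightarrow>\<^sub>0 'k"
  assume D: "is_coproduct G ord D" and x: "x \<in> alg G"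
  have basis: "D (basis F) = split_sum ord F" if "F \<in> Poly_Mapping.keys x" for F
  proof -
    from that x have "set (letters F) \<subseteq> conn_subgraphs G"
      by (auto simp: alg_def free_on_def monoid_of_def)
    from is_coproduct_basis[OF D this] show ?thesis by simp
  qed
  from D have "linear_on (free_on (monoid_of G)) (alg2 G) D"
    by (simp add: is_coproduct_def alg_def)
  from linear_on_free_expand[OF this] x
  have "D x = (\<Sum>F \<in> Poly_Mapping.keys x. smul (Poly_Mapping.lookup x F) (D (basis F)))"
    by (simp add: alg_def)
  also have "\<dots> = comb_coproduct ord x"
    \<comment> \<open>With the key set itself as index set, \<open>comb_coproduct_superset\<close>
      is the definition written with \<open>split_sum\<close>.\<close>
    by (simp add: basis comb_coproduct_superset[OF finite_keys order_refl])
  finally show "D x = comb_coproduct ord x" .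
qed

end
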